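(* Let $l$ be a real number and let $m=0$. The Lie algebra of Killing vector fields of the extended Bianchi-Cartan-Vranceanu space $(EBCV,\mathrm{ds}^2_{0,l})$ is $13$-dimensional.
   Context: For real numbers $l,m$, the extended Bianchi-Cartan-Vranceanu space $(EBCV,\mathrm{ds}^2_{m,l})$ is the 7-dimensional Riemannian manifold with coordinates $(w,x,y,z,r,s,t)$, where $K=1+m(w^2+x^2+y^2+z^2)>0$, and metric $$\mathrm{ds}^2_{m,l}=\frac{dw^2+dx^2+dy^2+dz^2}{K^2}+\Big(dr+\frac{l}{2}\frac{w\,dx-x\,dw+y\,dz-z\,dy}{K}\Big)^2+\Big(ds+\frac{l}{2}\frac{w\,dy-y\,dw+z\,dx-x\,dz}{K}\Big)^2+\Big(dt+\frac{l}{2}\frac{w\,dz-z\,dw+x\,dy-y\,dx}{K}\Big)^2 .$$ When $m=0$ one has $K=1$, the underlying manifold is $\mathbb{R}^7$, and the metrics form a one-parameter family depending on $l$. A vector field $X$ on a Riemannian manifold with metric $g$ is a Killing vector field if the Lie derivative of the metric along $X$ vanishes, $\mathcal{L}_X g=0$; the Killing vector fields form a real Lie algebra under the Lie bracket.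
   Formalization: The formal theorem assumes l ≠ 0; for l = 0 (and m = 0) the metric is the flat Euclidean metric on R^7, whose Killing fields form a 28-dimensional space, so the claim fails there. *)

theory Defs
  imports "HOL-Analysis.Analysis" "HOL-Library.Function_Algebras"
begin

section \<open>Smooth vector fields on open subsets of a Euclidean space\<close>

text \<open>
  \<open>Ck_on k f S\<close> is meant for open \<open>S\<close>: all iterated directional derivatives of \<open>f\<close> up to order \<open>k\<close>
  exist and are continuous on \<open>S\<close>.
\<close>

primrec Ck_on ::
  "nat \<Rightarrow> ('a::euclidean_space \<Rightarrow> 'b::real_normed_vector) \<Rightarrow> 'a set \<Rightarrow> bool" where
  "Ck_on 0 f S \<longleftrightarrow> continuous_on S f"
| "Ck_on (Suc k) f S \<longleftrightarrow>
     (\<forall>p\<in>S. f differentiable at p) \<and> (\<forall>v. Ck_on k (\<lambda>p. frechet_derivative f (at p) v) S)"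

definition smooth_on :: "('a::euclidean_space \<Rightarrow> 'b::real_normed_vector) \<Rightarrow> 'a set \<Rightarrow> bool" where
  "smooth_on f S \<longleftrightarrow> (\<forall>k. Ck_on k f S)"

text \<open>
  A vector field on an open set \<open>M\<close> is a total function; it is required to vanish outside \<open>M\<close>,
  so that two fields are equal as functions iff they agree on \<open>M\<close>.
\<close>

definition vector_fields :: "'a::euclidean_space set \<Rightarrow> ('a \<Rightarrow> 'a) set" where
  "vector_fields M = {X. smooth_on X M \<and> (\<forall>p. p \<notin> M \<longrightarrow> X p = 0)}"

definition lie_bracket ::
  "('a::euclidean_space \<Rightarrow> 'a) \<Rightarrow> ('a \<Rightarrow> 'a) \<Rightarrow> 'a \<Rightarrow> 'a" where
  "lie_bracket X Y p = frechet_derivative Y (at p) (X p) - frechet_derivative X (at p) (Y p)"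


section \<open>Killing vector fields\<close>

type_synonym 'a metric_tensor = "'a \<Rightarrow> 'a \<Rightarrow> 'a \<Rightarrow> real"  \<comment> \<open>\<open>g p u v\<close> is \<open>g\<^sub>p(u, v)\<close>\<close>

text \<open>\<open>(\<L>\<^sub>X g)(Y, Z) = X (g(Y, Z)) - g([X, Y], Z) - g(Y, [X, Z])\<close>\<close>

definition lie_derivative_metric ::
  "('a::euclidean_space \<Rightarrow> 'a) \<Rightarrow> 'a metric_tensor \<Rightarrow> ('a \<Rightarrow> 'a) \<Rightarrow> ('a \<Rightarrow> 'a) \<Rightarrow> 'a \<Rightarrow> real" where
  "lie_derivative_metric X g Y Z p =
     frechet_derivative (\<lambda>q. g q (Y q) (Z q)) (at p) (X p)
     - g p (lie_bracket X Y p) (Z p) - g p (Y p) (lie_bracket X Z p)"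

definition killing_fields :: "'a::euclidean_space set \<Rightarrow> 'a metric_tensor \<Rightarrow> ('a \<Rightarrow> 'a) set" where
  "killing_fields M g =
     {X \<in> vector_fields M.
        \<forall>Y\<in>vector_fields M. \<forall>Z\<in>vector_fields M. \<forall>p\<in>M. lie_derivative_metric X g Y Z p = 0}"

text \<open>Functions into a real vector space, with pointwise operations, form a real vector space.\<close>

abbreviation scale_field :: "real \<Rightarrow> ('a \<Rightarrow> 'b::real_vector) \<Rightarrow> 'a \<Rightarrow> 'b" where
  "scale_field c X \<equiv> (\<lambda>p. c *\<^sub>R X p)"

interpretation field_space: vector_space "scale_field :: real \<Rightarrow> ('a \<Rightarrow> 'b::real_vector) \<Rightarrow> 'a \<Rightarrow> 'b"
  by standard (auto simp: fun_eq_iff scaleR_add_right scaleR_add_left)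


section \<open>The extended Bianchi-Cartan-Vranceanu space\<close>

text \<open>
  The coordinates \<open>(w, x, y, z, r, s, t)\<close> of a point \<open>p\<close> are \<open>(p$1, p$2, \<dots>, p$7)\<close>, and a tangent
  vector \<open>u\<close> has the components \<open>dw(u) = u$1, \<dots>, dt(u) = u$7\<close>.
\<close>

definition ebcv_K :: "real \<Rightarrow> real^7 \<Rightarrow> real" where
  "ebcv_K m p = 1 + m * ((p$1)\<^sup>2 + (p$2)\<^sup>2 + (p$3)\<^sup>2 + (p$4)\<^sup>2)"

definition EBCV :: "real \<Rightarrow> (real^7) set" where
  "EBCV m = {p. ebcv_K m p > 0}"

definition ebcv_r :: "real \<Rightarrow> real \<Rightarrow> real^7 \<Rightarrow> real^7 \<Rightarrow> real" where
  "ebcv_r m l p u =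
     u$5 + l / 2 * ((p$1 * u$2 - p$2 * u$1 + p$3 * u$4 - p$4 * u$3) / ebcv_K m p)"

definition ebcv_s :: "real \<Rightarrow> real \<Rightarrow> real^7 \<Rightarrow> real^7 \<Rightarrow> real" where
  "ebcv_s m l p u =
     u$6 + l / 2 * ((p$1 * u$3 - p$3 * u$1 + p$4 * u$2 - p$2 * u$4) / ebcv_K m p)"

definition ebcv_t :: "real \<Rightarrow> real \<Rightarrow> real^7 \<Rightarrow> real^7 \<Rightarrow> real" where
  "ebcv_t m l p u =
     u$7 + l / 2 * ((p$1 * u$4 - p$4 * u$1 + p$2 * u$3 - p$3 * u$2) / ebcv_K m p)"

text \<open>
  The bilinear form is the polarization of the quadratic form \<open>ds\<^sup>2\<close>. For \<open>m = l = 0\<close> it is the flat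
  metric of \<open>\<real>\<^sup>7\<close>, whose Killing fields form a 28-dimensional space; the family has its generic
  symmetry only for \<open>l \<noteq> 0\<close>.
\<close>

definition ebcv_metric :: "real \<Rightarrow> real \<Rightarrow> (real^7) metric_tensor" where
  "ebcv_metric m l p u v =
     (u$1 * v$1 + u$2 * v$2 + u$3 * v$3 + u$4 * v$4) / (ebcv_K m p)\<^sup>2
     + ebcv_r m l p u * ebcv_r m l p v
     + ebcv_s m l p u * ebcv_s m l p v
     + ebcv_t m l p u * ebcv_t m l p v"


section \<open>The Killing fields form a linear subspace\<close>

lemma Ck_on_cong:
  assumes "open S" "\<And>p. p \<in> S \<Longrightarrow> f p = g p" "Ck_on k f S"
  shows "Ck_on k g S"
  using assms(2,3)
proof (induction k arbitrary: f g)
  case 0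
  then show ?case by (auto cong: continuous_on_cong)
next
  case (Suc k)
  have d: "f differentiable at p" if "p \<in> S" for p using Suc.prems that by auto
  have hg: "(g has_derivative frechet_derivative f (at p)) (at p)" if "p \<in> S" for p
  proof -
    have "(f has_derivative frechet_derivative f (at p)) (at p)"
      using d[OF that] by (simp add: frechet_derivative_works)
    then show ?thesis
      using assms(1) that Suc.prems(1) by (rule has_derivative_transform_within_open)
  qed
  have e: "frechet_derivative g (at p) = frechet_derivative f (at p)" if "p \<in> S" for p
    using frechet_derivative_at[OF hg[OF that]] by simp
  have "Ck_on k (\<lambda>p. frechet_derivative g (at p) v) S" for v
    by (rule Suc.IH[of "\<lambda>p. frechet_derivative f (at p) v"]) (use e Suc.prems in auto)
  then show ?case using hg unfolding Ck_on.simps differentiable_def by blast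
qed

lemma frechet_derivative_lin:
  assumes "f differentiable at p" "g differentiable at p"
  shows "frechet_derivative (\<lambda>q. f q + c *\<^sub>R g q) (at p) =
    (\<lambda>v. frechet_derivative f (at p) v + c *\<^sub>R frechet_derivative g (at p) v)"
proof -
  have "((\<lambda>q. f q + c *\<^sub>R g q) has_derivative
    (\<lambda>v. frechet_derivative f (at p) v + c *\<^sub>R frechet_derivative g (at p) v)) (at p)"
    using assms by (auto intro!: derivative_intros simp: frechet_derivative_works)
  then show ?thesis by (rule frechet_derivative_at[symmetric])
qed

lemma Ck_on_lin:
  assumes "open S" "Ck_on k f S" "Ck_on k g S"
  shows "Ck_on k (\<lambda>p. f p + c *\<^sub>R g p) S"
  using assms(2,3)
proof (induction k arbitrary: f g)
  case 0
  then show ?case by (auto intro!: continuous_intros)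
next
  case (Suc k)
  have "Ck_on k (\<lambda>p. frechet_derivative (\<lambda>p. f p + c *\<^sub>R g p) (at p) v) S" for v
    by (rule Ck_on_cong[OF assms(1) _ Suc.IH[of "\<lambda>p. frechet_derivative f (at p) v"
            "\<lambda>p. frechet_derivative g (at p) v"]])
      (use Suc.prems in \<open>auto simp: frechet_derivative_lin\<close>)
  moreover have "(\<lambda>p. f p + c *\<^sub>R g p) differentiable at p" if "p \<in> S" for p
    using Suc.prems that by (intro differentiable_add differentiable_scaleR) auto
  ultimately show ?case by simp
qed

lemma Ck_on_zero: "Ck_on k (\<lambda>_. 0) S"
  by (induction k) auto

lemma vector_fields_lin:
  assumes "open M" "X \<in> vector_fields M" "Y \<in> vector_fields M"
  shows "(\<lambda>p. X p + c *\<^sub>R Y p) \<in> vector_fields M"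
  using assms by (auto simp: vector_fields_def smooth_on_def Ck_on_lin)

lemma vector_fields_differentiable:
  assumes "X \<in> vector_fields M" "p \<in> M"
  shows "X differentiable at p"
proof -
  have "Ck_on (Suc 0) X M"
    using assms(1) unfolding vector_fields_def smooth_on_def by blast
  then show ?thesis using assms(2) by simp
qed

lemma open_EBCV: "open (EBCV m)"
  unfolding EBCV_def ebcv_K_def by (intro open_Collect_less continuous_intros)

lemma EBCV_0: "EBCV 0 = UNIV"
  by (simp add: EBCV_def ebcv_K_def)

lemma ebcv_form_lin:
  "ebcv_r m l p (u + c *\<^sub>R v) = ebcv_r m l p u + c * ebcv_r m l p v"
  "ebcv_s m l p (u + c *\<^sub>R v) = ebcv_s m l p u + c * ebcv_s m l p v"
  "ebcv_t m l p (u + c *\<^sub>R v) = ebcv_t m l p u + c * ebcv_t m l p v"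
proof -
  have "p$1 * (u + c *\<^sub>R v)$2 - p$2 * (u + c *\<^sub>R v)$1 + p$3 * (u + c *\<^sub>R v)$4 - p$4 * (u + c *\<^sub>R v)$3 =
      (p$1 * u$2 - p$2 * u$1 + p$3 * u$4 - p$4 * u$3) + c * (p$1 * v$2 - p$2 * v$1 + p$3 * v$4 - p$4 * v$3)"
    by (simp add: algebra_simps)
  then show "ebcv_r m l p (u + c *\<^sub>R v) = ebcv_r m l p u + c * ebcv_r m l p v"
    unfolding ebcv_r_def by (simp only: add_divide_distrib) (simp add: distrib_left)
  have "p$1 * (u + c *\<^sub>R v)$3 - p$3 * (u + c *\<^sub>R v)$1 + p$4 * (u + c *\<^sub>R v)$2 - p$2 * (u + c *\<^sub>R v)$4 =
      (p$1 * u$3 - p$3 * u$1 + p$4 * u$2 - p$2 * u$4) + c * (p$1 * v$3 - p$3 * v$1 + p$4 * v$2 - p$2 * v$4)"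
    by (simp add: algebra_simps)
  then show "ebcv_s m l p (u + c *\<^sub>R v) = ebcv_s m l p u + c * ebcv_s m l p v"
    unfolding ebcv_s_def by (simp only: add_divide_distrib) (simp add: distrib_left)
  have "p$1 * (u + c *\<^sub>R v)$4 - p$4 * (u + c *\<^sub>R v)$1 + p$2 * (u + c *\<^sub>R v)$3 - p$3 * (u + c *\<^sub>R v)$2 =
      (p$1 * u$4 - p$4 * u$1 + p$2 * u$3 - p$3 * u$2) + c * (p$1 * v$4 - p$4 * v$1 + p$2 * v$3 - p$3 * v$2)"
    by (simp add: algebra_simps)
  then show "ebcv_t m l p (u + c *\<^sub>R v) = ebcv_t m l p u + c * ebcv_t m l p v"
    unfolding ebcv_t_def by (simp only: add_divide_distrib) (simp add: distrib_left)
qed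

lemma ebcv_metric_sym: "ebcv_metric m l p u v = ebcv_metric m l p v u"
  by (simp add: ebcv_metric_def mult.commute)

lemma ebcv_metric_lin1:
  "ebcv_metric m l p (u + c *\<^sub>R u') v = ebcv_metric m l p u v + c * ebcv_metric m l p u' v"
proof -
  have "(u + c *\<^sub>R u')$1 * v$1 + (u + c *\<^sub>R u')$2 * v$2
        + (u + c *\<^sub>R u')$3 * v$3 + (u + c *\<^sub>R u')$4 * v$4
      = (u$1 * v$1 + u$2 * v$2 + u$3 * v$3 + u$4 * v$4)
        + c * (u'$1 * v$1 + u'$2 * v$2 + u'$3 * v$3 + u'$4 * v$4)"
    by (simp add: algebra_simps)
  then show ?thesis
    unfolding ebcv_metric_def ebcv_form_lin
    by (simp add: add_divide_distrib distrib_left distrib_right)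
qed

lemma ebcv_metric_lin2:
  "ebcv_metric m l p v (u + c *\<^sub>R u') = ebcv_metric m l p v u + c * ebcv_metric m l p v u'"
  using ebcv_metric_lin1 ebcv_metric_sym by metis

lemma ebcv_metric_pos:
  assumes "p \<in> EBCV m" "u \<noteq> 0"
  shows "ebcv_metric m l p u u > 0"
proof -
  have K: "ebcv_K m p > 0" using assms(1) by (simp add: EBCV_def)
  define A where "A = u$1 * u$1 + u$2 * u$2 + u$3 * u$3 + u$4 * u$4"
  define B where "B = (ebcv_r m l p u)\<^sup>2 + (ebcv_s m l p u)\<^sup>2 + (ebcv_t m l p u)\<^sup>2"
  have g: "ebcv_metric m l p u u = A / (ebcv_K m p)\<^sup>2 + B"
    by (simp add: ebcv_metric_def A_def B_def power2_eq_square)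
  have AB: "A \<ge> 0" "B \<ge> 0" by (simp_all add: A_def B_def)
  have "A > 0 \<or> B > 0"
  proof (rule ccontr)
    assume "\<not> (A > 0 \<or> B > 0)"
    with AB have z: "A = 0" "B = 0" by auto
    have u4: "u$1 = 0" "u$2 = 0" "u$3 = 0" "u$4 = 0"
      using z(1) unfolding A_def by (simp_all add: add_nonneg_eq_0_iff)
    have "ebcv_r m l p u = 0 \<and> ebcv_s m l p u = 0 \<and> ebcv_t m l p u = 0"
      using z(2) unfolding B_def by (simp add: add_nonneg_eq_0_iff)
    then have u7: "u$5 = 0" "u$6 = 0" "u$7 = 0"
      by (simp_all add: ebcv_r_def ebcv_s_def ebcv_t_def u4)
    have "u $ i = 0" for i
    proof -
      have "UNIV = {1, 2, 3, 4, 5, 6, 7 :: 7}"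
        by (rule sym, rule card_subset_eq) auto
      then have "i \<in> {1, 2, 3, 4, 5, 6, 7}" by blast
      then show ?thesis using u4 u7 by auto
    qed
    then have "u = 0" by (simp add: vec_eq_iff)
    with assms(2) show False ..
  qed
  then show ?thesis unfolding g using AB K by (auto simp: add_pos_nonneg add_nonneg_pos)
qed

lemma vec_nth_differentiable:
  "f differentiable F \<Longrightarrow> (\<lambda>q. (f q :: real^7) $ i) differentiable F"
  unfolding differentiable_def using bounded_linear.has_derivative[OF bounded_linear_vec_nth] by blast

lemma ebcv_metric_differentiable:
  assumes "p \<in> EBCV m" "Y differentiable at p" "Z differentiable at p"
  shows "(\<lambda>q. ebcv_metric m l q (Y q) (Z q)) differentiable at p"
proof -
  have "1 + m * ((p$1)\<^sup>2 + (p$2)\<^sup>2 + (p$3)\<^sup>2 + (p$4)\<^sup>2) \<noteq> 0"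
    using assms(1) by (simp add: EBCV_def ebcv_K_def)
  then show ?thesis
    unfolding ebcv_metric_def ebcv_r_def ebcv_s_def ebcv_t_def ebcv_K_def
    by (intro differentiable_add differentiable_mult differentiable_divide differentiable_diff
        differentiable_power differentiable_const vec_nth_differentiable differentiable_ident assms(2,3))
      simp_all
qed

lemma lie_derivative_ebcv_lin:
  assumes "p \<in> EBCV m" "X differentiable at p" "W differentiable at p"
    "Y differentiable at p" "Z differentiable at p"
  shows "lie_derivative_metric (\<lambda>p. X p + c *\<^sub>R W p) (ebcv_metric m l) Y Z p =
    lie_derivative_metric X (ebcv_metric m l) Y Z p
      + c * lie_derivative_metric W (ebcv_metric m l) Y Z p"
proof -
  have lin: "linear (frechet_derivative f (at p))" if "f differentiable at p"
    for f :: "real^7 \<Rightarrow> 'b::real_normed_vector"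
    using that linear_frechet_derivative by blast
  have br: "lie_bracket (\<lambda>p. X p + c *\<^sub>R W p) V p = lie_bracket X V p + c *\<^sub>R lie_bracket W V p"
    if "V differentiable at p" for V
    using lin[OF that] assms
    by (simp add: lie_bracket_def frechet_derivative_lin linear_add linear_scale algebra_simps)
  have lg: "linear (frechet_derivative (\<lambda>q. ebcv_metric m l q (Y q) (Z q)) (at p))"
    using ebcv_metric_differentiable[OF assms(1,4,5)] linear_frechet_derivative by blast
  show ?thesis
    unfolding lie_derivative_metric_def br[OF assms(4)] br[OF assms(5)] ebcv_metric_lin1 ebcv_metric_lin2
      linear_add[OF lg] linear_scale[OF lg]
    by (simp add: algebra_simps)
qed

lemma subspace_killing_fields_EBCV:
  "field_space.subspace (killing_fields (EBCV m) (ebcv_metric m l))"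
proof -
  let ?K = "killing_fields (EBCV m) (ebcv_metric m l)"
  have lin: "(\<lambda>p. X p + c *\<^sub>R W p) \<in> ?K" if "X \<in> ?K" "W \<in> ?K" for X W c
    using that unfolding killing_fields_def
    by (auto simp: vector_fields_lin open_EBCV lie_derivative_ebcv_lin vector_fields_differentiable)
  have zv: "(\<lambda>_. 0) \<in> vector_fields (EBCV m)"
    by (simp add: vector_fields_def smooth_on_def Ck_on_zero)
  have zero: "(\<lambda>_. 0) \<in> ?K"
  proof -
    have "lie_derivative_metric (\<lambda>_. 0) (ebcv_metric m l) Y Z p = 0"
      if "Y \<in> vector_fields (EBCV m)" "Z \<in> vector_fields (EBCV m)" "p \<in> EBCV m" for Y Z p
      using lie_derivative_ebcv_lin[of p m "\<lambda>_. 0" "\<lambda>_. 0" Y Z 1 l]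
        vector_fields_differentiable[OF that(1,3)] vector_fields_differentiable[OF that(2,3)] that(3)
      by simp
    with zv show ?thesis by (simp add: killing_fields_def)
  qed
  show ?thesis
    unfolding field_space.subspace_def
  proof (intro conjI ballI allI)
    show "0 \<in> ?K" using zero by (simp add: zero_fun_def)
    show "X + W \<in> ?K" if "X \<in> ?K" "W \<in> ?K" for X W
      using lin[OF that, of 1] by (simp add: plus_fun_def)
    show "scale_field c X \<in> ?K" if "X \<in> ?K" for c X
      using lin[OF zero that, of c] by simp
  qed
qed

end

theory Submission
  imports Defs
begin

text \<open>
  For \<open>m = 0\<close> the metric is invariant under a two-step nilpotent group structure on \<open>\<real>\<^sup>4 \<times> \<real>\<^sup>3\<close>, the
  quaternionic Heisenberg group: with \<open>\<real>\<^sup>4\<close> read as the quaternions, the bracket of two horizontal vectors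
  is, up to the factor \<open>l\<close>, the imaginary part of one times the conjugate of the other. The seven group
  translations and the six rotations of \<open>\<real>\<^sup>4\<close> by left and right multiplication with imaginary quaternions,
  extended to the center as derivations of the bracket, give \<open>4 + 3 + 3 + 3 = 13\<close> independent Killing fields
  (\<open>affine_field_killing\<close>, \<open>inj_affine_field\<close>). The work is to show that there are no others.

  Let \<open>f\<close> and \<open>h\<close> be the horizontal and central components of a Killing field in the invariant coframe.
  A Killing field pairs to a constant with the direction of a geodesic. Applied to the central lines in
  direction \<open>\<eta>\<close>, this makes \<open>\<eta> \<bullet> h\<close> invariant under translation by \<open>\<eta>\<close>, and so are its derivatives. The
  mixed part of the Killing equation then becomes an equation \<open>g' = - l *\<^sub>R J \<eta> g + const\<close> for \<open>f\<close> on such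
  a line, where \<open>J \<eta>\<close>, the left multiplication by \<open>\<eta>\<close>, is a complex structure if \<open>\<eta>\<close> has norm one. Hence \<open>f\<close> has the period
  \<open>2 * pi / \<bar>l\<bar>\<close> on every central line, whatever its direction. As the center has dimension at least two,
  every central vector is a sum of two vectors whose norms are a multiple of that period, and therefore \<open>f\<close>
  does not depend on the central coordinates at all (\<open>f_central_constant\<close>). For \<open>l = 0\<close> this
  fails, because flat space has rotations that mix the two factors.

  Now \<open>f\<close> is a Killing field of flat \<open>\<real>\<^sup>4\<close>, so \<open>f = v + B q\<close> with \<open>B\<close> skew (\<open>f_affine\<close>), and \<open>h\<close> is
  found by integrating the mixed equation along rays (\<open>h_from_center\<close>). It involves a skew map \<open>H\<close> of the
  center, for which the remaining equations say that \<open>(B, H)\<close> is a derivation of the bracket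
  (\<open>rotations_form_derivation\<close>). Since the brackets exhaust the center, \<open>H\<close> is determined by \<open>B\<close>, and the
  field is one of the thirteen-parameter family. The argument uses first derivatives only. It is
  carried out for all groups of Heisenberg type with a center of dimension at least two; the quaternions enter
  only in the determination of the skew derivations.
\<close>

section \<open>Skew maps, rotations and norms in Euclidean spaces\<close>

lemma eq_by_inner:
  fixes x y :: "'a::real_inner"
  assumes "\<And>z. z \<bullet> x = z \<bullet> y"
  shows "x = y"
  using assms vector_eq_ldot by blast

text \<open>
  This is the classification of the Killing fields of flat space: such a field pairs to a constant with
  the direction of each straight line, which is the hypothesis. No regularity is required, because the
  polarized hypothesis expresses \<open>L x \<bullet> y\<close> through \<open>L y\<close> alone and so makes it linear in \<open>x\<close>.
\<close>

lemma skew_isometry_field_affine: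
  fixes F :: "'a::real_inner \<Rightarrow> 'a"
  assumes "\<And>p q. (F p - F q) \<bullet> (p - q) = 0"
  obtains L where "linear L" "\<And>x. L x \<bullet> x = 0" "\<And>p. F p = F 0 + L p"
proof
  define L where "L p = F p - F 0" for p
  show F: "F p = F 0 + L p" for p
    by (simp add: L_def)
  show skew: "L x \<bullet> x = 0" for x
    using assms[of x 0] by (simp add: L_def)
  have adj: "y \<bullet> L x = - (L y \<bullet> x)" for x y
  proof -
    have "(L x - L y) \<bullet> (x - y) = 0"
      using assms[of x y] by (simp add: L_def)
    then show ?thesis
      using skew[of x] skew[of y] by (simp add: algebra_simps inner_commute)
  qed
  show "linear L"
  proof (rule linearI)
    show "L (x + y) = L x + L y" for x y
      by (rule eq_by_inner) (simp add: adj inner_add_right)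
    show "L (c *\<^sub>R x) = c *\<^sub>R L x" for c x
      by (rule eq_by_inner) (simp add: adj)
  qed
qed

lemma skew_adjoint:
  fixes L :: "'a::real_inner \<Rightarrow> 'a"
  assumes "linear L" "\<And>x. L x \<bullet> x = 0"
  shows "L x \<bullet> y = - (L y \<bullet> x)"
proof -
  have "L (x + y) \<bullet> (x + y) = 0"
    by (rule assms(2))
  then show ?thesis
    using assms(2)[of x] assms(2)[of y]
    by (simp add: linear_add[OF assms(1)] inner_add_left inner_add_right)
qed

lemma constant_along_line:
  fixes g :: "real \<Rightarrow> 'a::real_normed_vector"
  assumes "\<And>s. (g has_vector_derivative 0) (at s)"
  shows "g s = g 0"
  using has_derivative_zero_unique[of UNIV g 0 s] assms
  by (simp add: has_vector_derivative_def)

text \<open>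
  After the shift by the fixed point of the flow, the solution moves on ellipses with angular frequency
  \<open>\<omega>\<close>; the proof undoes this rotation and finds a constant \<open>W\<close>.
\<close>

lemma rotating_ode_periodic:
  fixes g :: "real \<Rightarrow> 'a::real_normed_vector"
  assumes M: "bounded_linear M" and sq: "\<And>x. M (M x) = - ((\<omega>\<^sup>2) *\<^sub>R x)" and "\<omega> \<noteq> 0"
    and ode: "\<And>s. (g has_vector_derivative M (g s) + k) (at s)"
  shows "g (2 * pi * real n / \<omega>) = g 0"
proof -
  interpret M: bounded_linear M by (rule M)
  define V where "V s = g s - (1 / \<omega>\<^sup>2) *\<^sub>R M k" for s
  have MV: "M (V s) = M (g s) + k" for s
    using \<open>\<omega> \<noteq> 0\<close> by (simp add: V_def M.diff M.scaleR sq)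
  have V': "(V has_vector_derivative M (V s)) (at s)" for s
    unfolding MV unfolding V_def
    using has_vector_derivative_diff[OF ode[of s] has_vector_derivative_const[of "(1 / \<omega>\<^sup>2) *\<^sub>R M k"]]
    by simp
  define W where "W s = cos (\<omega> * s) *\<^sub>R V s - (sin (\<omega> * s) / \<omega>) *\<^sub>R M (V s)" for s
  have "(W has_vector_derivative 0) (at s)" for s
  proof -
    have c: "((\<lambda>s. cos (\<omega> * s)) has_real_derivative - \<omega> * sin (\<omega> * s)) (at s)"
      and sn: "((\<lambda>s. sin (\<omega> * s) / \<omega>) has_real_derivative cos (\<omega> * s)) (at s)"
      using \<open>\<omega> \<noteq> 0\<close> by (auto intro!: derivative_eq_intros)
    have "(W has_vector_derivative
        (cos (\<omega> * s) *\<^sub>R M (V s) + (- \<omega> * sin (\<omega> * s)) *\<^sub>R V s)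
        - ((sin (\<omega> * s) / \<omega>) *\<^sub>R M (M (V s)) + cos (\<omega> * s) *\<^sub>R M (V s))) (at s)"
      unfolding W_def
      by (intro has_vector_derivative_diff has_vector_derivative_scaleR c sn V'
          M.has_vector_derivative)
    then show ?thesis
      using \<open>\<omega> \<noteq> 0\<close> by (simp add: sq power2_eq_square mult.commute)
  qed
  from constant_along_line[of W, OF this]
  have "W (2 * pi * real n / \<omega>) = W 0" .
  moreover have "\<omega> * (2 * pi * real n / \<omega>) = 2 * pi * real n"
    using \<open>\<omega> \<noteq> 0\<close> by simp
  ultimately have "V (2 * pi * real n / \<omega>) = V 0"
    using sin_2npi[of n] cos_2npi[of n] by (simp add: W_def ac_simps)
  then show ?thesis
    by (simp add: V_def)
qed

text \<open>
  The two summands are the equal sides of an isosceles triangle with base \<open>x\<close>; a second dimension is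
  what makes room for its height \<open>w\<close>.
\<close>

lemma sum_of_two_of_equal_norm:
  fixes x :: "'a::euclidean_space"
  assumes "DIM('a) \<ge> 2" "norm x \<le> 2 * r"
  obtains a b where "x = a + b" "norm a = r" "norm b = r"
proof -
  obtain y where y: "y \<noteq> 0" "orthogonal x y"
    using orthogonal_to_vector_exists[OF assms(1)] by blast
  have r: "0 \<le> r"
    using assms(2) norm_ge_zero[of x] by linarith
  define d where "d = sqrt (r\<^sup>2 - (norm x)\<^sup>2 / 4)"
  define w where "w = (d / norm y) *\<^sub>R y"
  have "(norm x)\<^sup>2 \<le> (2 * r)\<^sup>2"
    using assms(2) by (intro power_mono) auto
  then have d: "d\<^sup>2 = r\<^sup>2 - (norm x)\<^sup>2 / 4"
    by (simp add: d_def power_mult_distrib)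
  have xw: "x \<bullet> w = 0"
    using y(2) by (simp add: w_def orthogonal_def)
  have ww: "w \<bullet> w = d\<^sup>2"
    using y(1) by (simp add: w_def power2_norm_eq_inner[symmetric] power2_eq_square divide_simps)
  have "(norm ((1/2) *\<^sub>R x + w))\<^sup>2 = r\<^sup>2" "(norm ((1/2) *\<^sub>R x - w))\<^sup>2 = r\<^sup>2"
    unfolding power2_norm_eq_inner using xw ww d
    by (simp_all add: inner_commute algebra_simps power2_norm_eq_inner)
  then have "norm ((1/2) *\<^sub>R x + w) = r" "norm ((1/2) *\<^sub>R x - w) = r"
    using r power2_eq_imp_eq by auto
  moreover have "x = ((1/2) *\<^sub>R x + w) + ((1/2) *\<^sub>R x - w)"
    by (simp add: scaleR_left_distrib[symmetric])
  ultimately show thesis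
    using that by blast
qed

section \<open>Killing fields on groups of Heisenberg type\<close>

text \<open>
  The alternating map \<open>om\<close> is the bracket of a two-step nilpotent Lie algebra with horizontal part \<open>'e\<close>
  and center \<open>'z\<close>. That each unit vector of the center acts as a complex structure \<open>J \<eta>\<close> on the
  horizontal part is Kaplan's condition for an algebra of Heisenberg type.
\<close>

locale heisenberg_type = bounded_bilinear om
  for om :: "'e::euclidean_space \<Rightarrow> 'e \<Rightarrow> 'z::euclidean_space" +
  fixes J :: "'z \<Rightarrow> 'e \<Rightarrow> 'e"
  assumes om_self: "om u u = 0"
    and J_adjoint: "J \<eta> u \<bullet> v = \<eta> \<bullet> om u v"
    and J_square: "J \<eta> (J \<eta> u) = - ((norm \<eta>)\<^sup>2 *\<^sub>R u)"
begin

lemma om_skew: "om u v = - om v u"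
proof -
  have "om u v + om v u = om (u + v) (u + v)"
    by (simp only: add_left add_right) (simp add: om_self)
  also have "\<dots> = 0"
    by (rule om_self)
  finally show ?thesis
    by (simp only: eq_neg_iff_add_eq_0)
qed

lemma J_skew: "J \<eta> u \<bullet> v = - (u \<bullet> J \<eta> v)"
  using om_skew[of u v] by (simp add: J_adjoint inner_commute[of u])

lemma inner_J: "v \<bullet> J \<eta> u = \<eta> \<bullet> om u v"
  by (simp add: inner_commute[of v] J_adjoint)

lemma linear_J: "linear (J \<eta>)"
proof (rule linearI)
  show "J \<eta> (x + y) = J \<eta> x + J \<eta> y" for x y
    by (rule eq_by_inner) (simp add: inner_add_right inner_J add_left)
  show "J \<eta> (c *\<^sub>R x) = c *\<^sub>R J \<eta> x" for c x
    by (rule eq_by_inner) (simp add: inner_J scaleR_left)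
qed

end

text \<open>
  The one-form \<open>dc + (l / 2) *\<^sub>R om q dq\<close> and \<open>dq\<close> make up an orthonormal coframe for a metric on
  \<open>'e \<times> 'z\<close>, and \<open>f\<close> and \<open>h\<close> are the horizontal and central components of a vector field in that coframe.
  The vector \<open>(u, \<eta> - (l / 2) *\<^sub>R om q u)\<close> at \<open>(q, c)\<close> has the components \<open>u\<close> and \<open>\<eta>\<close>; the assumption
  \<open>killing\<close> says that the Lie derivative of the metric vanishes on each such vector paired with itself.
  The term on the right comes from the derivative of the coframe.
\<close>

locale heisenberg_killing = heisenberg_type om J
  for om :: "'e::euclidean_space \<Rightarrow> 'e \<Rightarrow> 'z::euclidean_space" and J +
  fixes l :: real
    and f :: "'e \<times> 'z \<Rightarrow> 'e" and f' and h :: "'e \<times> 'z \<Rightarrow> 'z" and h'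
  assumes l: "l \<noteq> 0" and dim_center: "2 \<le> DIM('z)"
    and f': "(f has_derivative f' p) (at p)"
    and h': "(h has_derivative h' p) (at p)"
    and killing: "u \<bullet> f' (q, c) (u, \<eta> - (l / 2) *\<^sub>R om q u)
       + \<eta> \<bullet> h' (q, c) (u, \<eta> - (l / 2) *\<^sub>R om q u) = l * (\<eta> \<bullet> om u (f (q, c)))"
begin

lemma f'_linear: "linear (f' p)" and h'_linear: "linear (h' p)"
  using f' h' has_derivative_linear by blast+

text \<open>
  The Killing identity is a quadratic form in \<open>(u, \<eta>)\<close>; this and the next two lemmas are its
  homogeneous parts.
\<close>

lemma killing_vertical: "\<eta> \<bullet> h' (q, c) (0, \<eta>) = 0"
  using killing[of 0 q c \<eta>] by (simp add: zero_right zero_left)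

lemma killing_horizontal: "u \<bullet> f' (q, c) (u, - (l / 2) *\<^sub>R om q u) = 0"
  using killing[of u q c 0] by simp

lemma killing_mixed:
  "u \<bullet> f' (q, c) (0, \<eta>) + \<eta> \<bullet> h' (q, c) (u, - (l / 2) *\<^sub>R om q u) = l * (\<eta> \<bullet> om u (f (q, c)))"
proof -
  have split: "(u, \<eta> - (l / 2) *\<^sub>R om q u) = (0, \<eta>) + (u, - (l / 2) *\<^sub>R om q u)"
    by simp
  show ?thesis
    using killing[of u q c \<eta>] killing_vertical[of \<eta> q c] killing_horizontal[of u q c]
    unfolding split linear_add[OF f'_linear] linear_add[OF h'_linear]
    by (simp add: inner_add_right)
qed

lemma along_line:
  shows "((\<lambda>s. f (p + s *\<^sub>R v)) has_vector_derivative f' (p + s *\<^sub>R v) v) (at s)"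
    and "((\<lambda>s. h (p + s *\<^sub>R v)) has_vector_derivative h' (p + s *\<^sub>R v) v) (at s)"
proof -
  have d: "((\<lambda>s. p + s *\<^sub>R v) has_vector_derivative v) (at s)"
    by (auto intro!: derivative_eq_intros simp: has_vector_derivative_def)
  show "((\<lambda>s. f (p + s *\<^sub>R v)) has_vector_derivative f' (p + s *\<^sub>R v) v) (at s)"
    "((\<lambda>s. h (p + s *\<^sub>R v)) has_vector_derivative h' (p + s *\<^sub>R v) v) (at s)"
    using vector_derivative_diff_chain_within[OF d has_derivative_at_withinI[OF f']]
      vector_derivative_diff_chain_within[OF d has_derivative_at_withinI[OF h']]
    by (simp_all add: o_def)
qed

lemma inner_along_line:
  shows "((\<lambda>s. w \<bullet> f (p + s *\<^sub>R v)) has_vector_derivative w \<bullet> f' (p + s *\<^sub>R v) v) (at s)"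
    and "((\<lambda>s. \<eta> \<bullet> h (p + s *\<^sub>R v)) has_vector_derivative \<eta> \<bullet> h' (p + s *\<^sub>R v) v) (at s)"
  by (rule bounded_linear.has_vector_derivative[OF bounded_linear_inner_right along_line(1)]
        bounded_linear.has_vector_derivative[OF bounded_linear_inner_right along_line(2)])+

text \<open>
  Central lines are geodesics, so a Killing field pairs to a constant with their direction.
\<close>

lemma h_vertical_invariant: "\<eta> \<bullet> h (p + (0, s *\<^sub>R \<eta>)) = \<eta> \<bullet> h p"
proof (cases p)
  case (Pair q c)
  have "((\<lambda>s. \<eta> \<bullet> h (p + s *\<^sub>R (0, \<eta>))) has_vector_derivative 0) (at s)" for s
    using inner_along_line(2)[of \<eta> p "(0, \<eta>)" s] by (simp add: Pair killing_vertical)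
  from constant_along_line[OF this, of s] show ?thesis
    by (simp add: Pair)
qed

text \<open>
  The preceding invariance is an identity of functions, so it can be differentiated although nothing is
  known about second derivatives.
\<close>

lemma h'_vertical_invariant: "\<eta> \<bullet> h' (p + (0, s *\<^sub>R \<eta>)) v = \<eta> \<bullet> h' p v"
proof -
  let ?a = "(0, s *\<^sub>R \<eta>)"
  have "((\<lambda>p. p + ?a) has_derivative (\<lambda>v. v)) (at p)"
    by (auto intro!: derivative_eq_intros)
  from has_derivative_compose[OF this h']
  have "((\<lambda>p. h (p + ?a)) has_derivative h' (p + ?a)) (at p)" .
  then have "((\<lambda>p. \<eta> \<bullet> h (p + ?a)) has_derivative (\<lambda>v. \<eta> \<bullet> h' (p + ?a) v)) (at p)"
    by (rule has_derivative_inner_right)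
  moreover have "((\<lambda>p. \<eta> \<bullet> h p) has_derivative (\<lambda>v. \<eta> \<bullet> h' p v)) (at p)"
    by (rule has_derivative_inner_right[OF h'])
  ultimately have "(\<lambda>v. \<eta> \<bullet> h' (p + ?a) v) = (\<lambda>v. \<eta> \<bullet> h' p v)"
    unfolding h_vertical_invariant by (rule has_derivative_unique)
  then show ?thesis
    by (rule fun_cong)
qed

text \<open>
  In the mixed part of the Killing identity the derivative of \<open>h\<close> does not change along a central line in
  direction \<open>\<eta>\<close>. What remains is a linear differential equation with constant coefficients for \<open>f\<close>,
  whose homogeneous part is the rotation generator \<open>- l *\<^sub>R J \<eta>\<close>.
\<close>

lemma f_central_ode:
  "((\<lambda>s. f ((q, c) + s *\<^sub>R (0, \<eta>))) has_vector_derivative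
     (- l) *\<^sub>R J \<eta> (f ((q, c) + s *\<^sub>R (0, \<eta>))) + (f' (q, c) (0, \<eta>) + l *\<^sub>R J \<eta> (f (q, c)))) (at s)"
proof -
  have *: "f' (q, c + s *\<^sub>R \<eta>) (0, \<eta>) + l *\<^sub>R J \<eta> (f (q, c + s *\<^sub>R \<eta>))
      = f' (q, c) (0, \<eta>) + l *\<^sub>R J \<eta> (f (q, c))"
  proof -
    have "u \<bullet> (f' (q, c) (0, \<eta>) + l *\<^sub>R J \<eta> (f (q, c)))
        = - (\<eta> \<bullet> h' (q, c) (u, - (l / 2) *\<^sub>R om q u))" for u c
      using killing_mixed[of u q c \<eta>] J_skew[of \<eta> u "f (q, c)"]
      by (simp add: inner_add_right J_adjoint)
    moreover have "\<eta> \<bullet> h' (q, c + s *\<^sub>R \<eta>) v = \<eta> \<bullet> h' (q, c) v" for v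
      using h'_vertical_invariant[of \<eta> "(q, c)" s v] by simp
    ultimately show ?thesis
      by - (rule eq_by_inner, simp)
  qed
  show ?thesis
    using along_line(1)[of "(q, c)" "(0, \<eta>)" s]
    by (simp add: *[symmetric])
qed

text \<open>
  The period depends on \<open>l\<close> only, not on the direction \<open>\<eta>\<close>: all the maps \<open>J \<eta>\<close> with \<open>\<eta>\<close> of norm one square
  to minus the identity.
\<close>

lemma f_translation_period:
  assumes "norm \<eta> = 1"
  shows "f (q, c + (2 * pi * real n / l) *\<^sub>R \<eta>) = f (q, c)"
proof -
  have lin: "linear (\<lambda>x. (- l) *\<^sub>R J \<eta> x)"
    by (intro linear_compose_scale_right linear_J)
  have "bounded_linear (\<lambda>x. (- l) *\<^sub>R J \<eta> x)"
    using lin by (simp only: linear_conv_bounded_linear)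
  moreover have "(- l) *\<^sub>R J \<eta> ((- l) *\<^sub>R J \<eta> x) = - (l\<^sup>2 *\<^sub>R x)" for x
    by (simp add: linear_neg[OF linear_J] linear_scale[OF linear_J] J_square assms power2_eq_square)
  ultimately show ?thesis
    using rotating_ode_periodic[OF _ _ l f_central_ode[of q c \<eta>], of n] by simp
qed

lemma f_translation_norm:
  assumes "norm a = 2 * pi * real n / \<bar>l\<bar>"
  shows "f (q, c + a) = f (q, c)"
proof (cases "a = 0")
  case False
  define \<eta> where "\<eta> = (sgn l / norm a) *\<^sub>R a"
  have "norm \<eta> = 1"
    using False l by (simp add: \<eta>_def sgn_real_def)
  moreover have "(2 * pi * real n / l) *\<^sub>R \<eta> = a"
  proof -
    have "2 * pi * real n / l * (sgn l / norm a) = (2 * pi * real n / \<bar>l\<bar>) / norm a"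
      using l by (simp add: sgn_real_def)
    also have "\<dots> = 1"
      using False by (simp flip: assms)
    finally show ?thesis
      by (simp only: \<eta>_def scaleR_scaleR scaleR_one)
  qed
  ultimately show ?thesis
    using f_translation_period[of \<eta> q c n] by simp
qed simp

text \<open>
  Every central vector is a sum of two vectors whose norms are the same multiple of the period, and \<open>f\<close> is
  invariant under the translation by either of them.
\<close>

lemma f_central_constant: "f (q, c) = f (q, 0)"
proof -
  obtain n :: nat where n: "norm c * \<bar>l\<bar> / (4 * pi) \<le> real n"
    using real_arch_simple by blast
  have "norm c \<le> 2 * (2 * pi * real n / \<bar>l\<bar>)"
    using n l by (simp add: field_simps)
  then obtain a b where ab: "c = a + b"
    "norm a = 2 * pi * real n / \<bar>l\<bar>" "norm b = 2 * pi * real n / \<bar>l\<bar>"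
    using sum_of_two_of_equal_norm[OF dim_center] by blast
  show ?thesis
    using f_translation_norm[OF ab(3), of q a] f_translation_norm[OF ab(2), of q 0] ab(1) by simp
qed

text \<open>
  Horizontal lifts of straight lines are geodesics, so a Killing field pairs to a constant with
  their direction. As \<open>f\<close> ignores the center, this is the flat situation on the horizontal space.
\<close>

lemma f_affine:
  obtains B where "linear B" "\<And>x. B x \<bullet> x = 0" "\<And>q c. f (q, c) = f (0, 0) + B q"
proof -
  have flat: "(f (q, 0) - f (q', 0)) \<bullet> (q - q') = 0" for q q'
  proof -
    \<comment> \<open>The horizontal lift \<open>?v\<close> is taken at \<open>q'\<close> and stays horizontal along the line since \<open>om\<close> alternates.\<close>
    let ?u = "q - q'" and ?v = "(q - q', - (l / 2) *\<^sub>R om q' (q - q'))"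
    have "((\<lambda>s. ?u \<bullet> f ((q', 0) + s *\<^sub>R ?v)) has_vector_derivative 0) (at s)" for s
    proof -
      have "om (q' + s *\<^sub>R ?u) ?u = om q' ?u"
        by (simp only: add_left scaleR_left om_self) simp
      then show ?thesis
        using inner_along_line(1)[of ?u "(q', 0)" ?v s]
          killing_horizontal[of ?u "q' + s *\<^sub>R ?u" "s *\<^sub>R (- (l / 2) *\<^sub>R om q' ?u)"]
        by simp
    qed
    from constant_along_line[OF this, of 1]
    have "?u \<bullet> f (q, - (l / 2) *\<^sub>R om q' ?u) = ?u \<bullet> f (q', 0)"
      by simp
    then have "?u \<bullet> (f (q, 0) - f (q', 0)) = 0"
      using f_central_constant[of q "- (l / 2) *\<^sub>R om q' ?u"] by (simp only: inner_diff_right)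
    then show ?thesis
      by (simp only: inner_commute)
  qed
  obtain B where B: "linear B" "\<And>x. B x \<bullet> x = 0" "\<And>q. f (q, 0) = f (0, 0) + B q"
    by (fact skew_isometry_field_affine[of "\<lambda>q. f (q, 0)", OF flat])
  show thesis
    by (rule that[OF B(1,2)]) (metis B(3) f_central_constant)
qed

lemma h_on_center_affine:
  obtains H where "linear H" "\<And>x. H x \<bullet> x = 0" "\<And>c. h (0, c) = h (0, 0) + H c"
proof -
  have flat: "(h (0, c) - h (0, c')) \<bullet> (c - c') = 0" for c c'
    using h_vertical_invariant[of "c - c'" "(0, c')" 1]
    by (simp add: inner_diff_left inner_diff_right inner_commute)
  obtain H where "linear H" "\<And>x. H x \<bullet> x = 0" "\<And>c. h (0, c) = h (0, 0) + H c"
    by (fact skew_isometry_field_affine[of "\<lambda>c. h (0, c)", OF flat])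
  then show thesis
    by (rule that)
qed

lemma f'_eq:
  assumes "linear B" "\<And>q c. f (q, c) = v + B q"
  shows "f' p (u, \<eta>) = B u"
proof -
  have "bounded_linear B"
    using assms(1) by (simp only: linear_conv_bounded_linear)
  then have "((\<lambda>p. v + B (fst p)) has_derivative (\<lambda>d. B (fst d))) (at p)"
    by (auto intro!: derivative_eq_intros bounded_linear.has_derivative[of B])
  moreover have "f = (\<lambda>p. v + B (fst p))"
    using assms(2) by (metis prod.collapse)
  ultimately show ?thesis
    using has_derivative_unique[OF f'] by (metis fst_conv)
qed

text \<open>
  Along the ray through \<open>q\<close> in the slice of constant \<open>c\<close>, which is a horizontal curve, the mixed
  Killing identity prescribes the derivative of \<open>h\<close> in terms of the known \<open>f\<close>.
\<close>

lemma h_from_center: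
  assumes "linear B" "\<And>q c. f (q, c) = v + B q"
  shows "h (q, c) = h (0, c) + l *\<^sub>R om q v + (l / 2) *\<^sub>R om q (B q)"
proof -
  have "\<eta> \<bullet> h (q, c) = \<eta> \<bullet> (h (0, c) + l *\<^sub>R om q v + (l / 2) *\<^sub>R om q (B q))" for \<eta>
  proof -
    define \<phi> where "\<phi> s = \<eta> \<bullet> h ((0, c) + s *\<^sub>R (q, 0))
      - (s * (l * (\<eta> \<bullet> om q v)) + s\<^sup>2 * ((l / 2) * (\<eta> \<bullet> om q (B q))))" for s
    have "(\<phi> has_vector_derivative 0) (at s)" for s
    proof -
      have "\<eta> \<bullet> h' (s *\<^sub>R q, c) (q, 0) = l * (\<eta> \<bullet> om q v) + 2 * s * ((l / 2) * (\<eta> \<bullet> om q (B q)))"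
        using killing_mixed[of q "s *\<^sub>R q" c \<eta>] linear_0[OF assms(1)]
        by (simp add: f'_eq[OF assms] assms(2) scaleR_left om_self linear_scale[OF assms(1)]
            add_right scaleR_right inner_add_right algebra_simps)
      then have "((\<lambda>s. \<eta> \<bullet> h ((0, c) + s *\<^sub>R (q, 0))) has_real_derivative
          l * (\<eta> \<bullet> om q v) + 2 * s * ((l / 2) * (\<eta> \<bullet> om q (B q)))) (at s)"
        using inner_along_line(2)[of \<eta> "(0, c)" "(q, 0)" s]
        by (simp add: has_real_derivative_iff_has_vector_derivative)
      then have "(\<phi> has_real_derivative 0) (at s)"
        unfolding \<phi>_def by (auto intro!: derivative_eq_intros)
      then show ?thesis
        by (simp add: has_real_derivative_iff_has_vector_derivative)
    qed
    from constant_along_line[OF this, of 1] show ?thesis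
      by (simp add: \<phi>_def inner_add_right)
  qed
  then show ?thesis
    by (rule eq_by_inner)
qed

text \<open>
  The formula of the preceding lemma was obtained from rays through \<open>q = 0\<close> only. The Killing identity at
  the other points adds that the rotations \<open>B\<close> and \<open>H\<close> act together as a derivation of the bracket.
\<close>

lemma rotations_form_derivation:
  assumes B: "linear B" "\<And>q c. f (q, c) = v + B q"
    and H: "linear H" "\<And>c. h (0, c) = z + H c"
  shows "H (om q u) = om (B q) u + om q (B u)"
proof -
  have bl: "bounded_linear B" "bounded_linear H"
    using B(1) H(1) by (simp_all only: linear_conv_bounded_linear)
  have deriv: "((\<lambda>p. z + H (snd p) + l *\<^sub>R om (fst p) v + (l / 2) *\<^sub>R om (fst p) (B (fst p))) has_derivative
    (\<lambda>d. H (snd d) + l *\<^sub>R om (fst d) v + (l / 2) *\<^sub>R (om (fst p) (B (fst d)) + om (fst d) (B (fst p)))))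
    (at p)" for p
    by (auto intro!: derivative_eq_intros bounded_linear.has_derivative[OF bl(1)]
        bounded_linear.has_derivative[OF bl(2)] FDERIV simp: zero_right)
  have "(h has_derivative
    (\<lambda>d. H (snd d) + l *\<^sub>R om (fst d) v + (l / 2) *\<^sub>R (om (fst p) (B (fst d)) + om (fst d) (B (fst p)))))
    (at p)" for p
  proof -
    have "h = (\<lambda>p. z + H (snd p) + l *\<^sub>R om (fst p) v + (l / 2) *\<^sub>R om (fst p) (B (fst p)))"
      using h_from_center[OF B] H(2) by (auto simp: fun_eq_iff)
    then show ?thesis
      using deriv[of p] by simp
  qed
  then have h'_eq: "h' p d = H (snd d) + l *\<^sub>R om (fst d) v
      + (l / 2) *\<^sub>R (om (fst p) (B (fst d)) + om (fst d) (B (fst p)))" for p d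
    by (rule fun_cong[OF has_derivative_unique[OF h']])
  have "l * (\<eta> \<bullet> H (om q u)) = l * (\<eta> \<bullet> (om (B q) u + om q (B u)))" for \<eta>
    using killing_mixed[of u q 0 \<eta>] om_skew[of u "B q"] linear_0[OF B(1)]
    by (simp add: f'_eq[OF B] B(2) h'_eq linear_neg[OF H(1)] linear_scale[OF H(1)] add_right
        inner_add_right algebra_simps)
  then show ?thesis
    using l by - (rule eq_by_inner, simp)
qed

text \<open>
  The difference on the left of the last clause is the central component with respect to the coordinates
  instead of the coframe. In it the quadratic terms in \<open>q\<close> cancel, so a Killing field is affine in
  the coordinates: a translation of the group plus a skew derivation of its Lie algebra.
\<close>

theorem killing_classification:
  obtains B H v z where "linear B" "\<And>x. B x \<bullet> x = 0" "linear H" "\<And>x. H x \<bullet> x = 0"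
    "\<And>q u. H (om q u) = om (B q) u + om q (B u)"
    "\<And>q c. f (q, c) = v + B q"
    "\<And>q c. h (q, c) - (l / 2) *\<^sub>R om q (f (q, c)) = z + H c + (l / 2) *\<^sub>R om q v"
proof -
  obtain B where B: "linear B" "\<And>x. B x \<bullet> x = 0" "\<And>q c. f (q, c) = f (0, 0) + B q"
    by (fact f_affine)
  obtain H where H: "linear H" "\<And>x. H x \<bullet> x = 0" "\<And>c. h (0, c) = h (0, 0) + H c"
    by (fact h_on_center_affine)
  have h: "h (q, c) - (l / 2) *\<^sub>R om q (f (q, c)) = h (0, 0) + H c + (l / 2) *\<^sub>R om q (f (0, 0))" for q c
  proof -
    have "l *\<^sub>R om q (f (0, 0)) = (l / 2) *\<^sub>R om q (f (0, 0)) + (l / 2) *\<^sub>R om q (f (0, 0))"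
      by (simp add: scaleR_left_distrib[symmetric])
    then show ?thesis
      using h_from_center[OF B(1,3), of q c] H(3)[of c] B(3)[of q c]
      by (simp add: add_right scaleR_right_distrib)
  qed
  show thesis
    by (rule that[OF B(1,2) H(1,2) rotations_form_derivation[OF B(1,3) H(1,3)] B(3) h])
qed

end

section \<open>The seven-dimensional quaternionic model\<close>

lemma forall_4: "(\<forall>i::4. P i) \<longleftrightarrow> P 1 \<and> P 2 \<and> P 3 \<and> P 4"
  by (metis exhaust_4)

lemma forall_7: "(\<forall>i::7. P i) \<longleftrightarrow> P 1 \<and> P 2 \<and> P 3 \<and> P 4 \<and> P 5 \<and> P 6 \<and> P 7"
proof -
  have "(UNIV :: 7 set) = {1, 2, 3, 4, 5, 6, 7}"
    by (rule sym, rule card_subset_eq) auto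
  then have "(\<forall>i::7. P i) \<longleftrightarrow> (\<forall>i\<in>{1, 2, 3, 4, 5, 6, 7}. P i)"
    by auto
  then show ?thesis
    by simp
qed

lemma vector_components_4:
  "(vector [a, b, c, d] :: 'a::zero^4)$1 = a" "(vector [a, b, c, d] :: 'a^4)$2 = b"
  "(vector [a, b, c, d] :: 'a^4)$3 = c" "(vector [a, b, c, d] :: 'a^4)$4 = d"
  by (simp_all add: vector_def)

lemma vector_components_7:
  "(vector [a, b, c, d, e, f, g] :: 'a::zero^7)$1 = a"
  "(vector [a, b, c, d, e, f, g] :: 'a^7)$2 = b"
  "(vector [a, b, c, d, e, f, g] :: 'a^7)$3 = c"
  "(vector [a, b, c, d, e, f, g] :: 'a^7)$4 = d"
  "(vector [a, b, c, d, e, f, g] :: 'a^7)$5 = e"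
  "(vector [a, b, c, d, e, f, g] :: 'a^7)$6 = f"
  "(vector [a, b, c, d, e, f, g] :: 'a^7)$7 = g"
  by (simp_all add: vector_def)

lemmas components = vector_components_4 vector_components_7 vec_eq_iff forall_3 forall_4 forall_7

definition hor :: "real^7 \<Rightarrow> real^4" where
  "hor u = vector [u$1, u$2, u$3, u$4]"

definition ver :: "real^7 \<Rightarrow> real^3" where
  "ver u = vector [u$5, u$6, u$7]"

definition join :: "real^4 \<Rightarrow> real^3 \<Rightarrow> real^7" where
  "join a b = vector [a$1, a$2, a$3, a$4, b$1, b$2, b$3]"

lemma hor_join [simp]: "hor (join a b) = a"
  and ver_join [simp]: "ver (join a b) = b"
  and join_hor_ver [simp]: "join (hor u) (ver u) = u"
  by (simp_all add: hor_def ver_def join_def components)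

lemma join_add: "join (a + a') (b + b') = join a b + join a' b'"
  and join_scaleR: "join (r *\<^sub>R a) (r *\<^sub>R b) = r *\<^sub>R join a b"
  by (simp_all add: join_def components)

lemma linear_hor: "linear hor" and linear_ver: "linear ver"
  and linear_join: "linear (\<lambda>x. join (fst x) (snd x))"
  by (rule linearI; simp add: hor_def ver_def join_def components)+

lemma bounded_linear_hor: "bounded_linear hor" and bounded_linear_ver: "bounded_linear ver"
  and bounded_linear_join: "bounded_linear (\<lambda>x. join (fst x) (snd x))"
  using linear_hor linear_ver linear_join by (simp_all only: linear_conv_bounded_linear)

lemmas hor_linear_simps = linear_add[OF linear_hor] linear_scale[OF linear_hor] linear_diff[OF linear_hor]
  linear_add[OF linear_ver] linear_scale[OF linear_ver] linear_diff[OF linear_ver]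

text \<open>
  With \<open>q = (w, x, y, z)\<close> read as the quaternion \<open>w + x i + y j + z k\<close>, this is the imaginary part of
  \<open>u\<close> times the conjugate of \<open>q\<close>.
\<close>

definition quat_im :: "real^4 \<Rightarrow> real^4 \<Rightarrow> real^3" where
  "quat_im q u = vector
    [q$1 * u$2 - q$2 * u$1 + q$3 * u$4 - q$4 * u$3,
     q$1 * u$3 - q$3 * u$1 + q$4 * u$2 - q$2 * u$4,
     q$1 * u$4 - q$4 * u$1 + q$2 * u$3 - q$3 * u$2]"

text \<open>
  Multiplication of quaternions by the imaginary quaternion \<open>\<eta>\<close> from the left, and below from the right.
\<close>

definition lmult :: "real^3 \<Rightarrow> real^4 \<Rightarrow> real^4" where
  "lmult \<eta> u = vector
    [- \<eta>$1 * u$2 - \<eta>$2 * u$3 - \<eta>$3 * u$4,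
     \<eta>$1 * u$1 + \<eta>$2 * u$4 - \<eta>$3 * u$3,
     - \<eta>$1 * u$4 + \<eta>$2 * u$1 + \<eta>$3 * u$2,
     \<eta>$1 * u$3 - \<eta>$2 * u$2 + \<eta>$3 * u$1]"

definition rmult :: "real^3 \<Rightarrow> real^4 \<Rightarrow> real^4" where
  "rmult \<eta> u = vector
    [- \<eta>$1 * u$2 - \<eta>$2 * u$3 - \<eta>$3 * u$4,
     \<eta>$1 * u$1 - \<eta>$2 * u$4 + \<eta>$3 * u$3,
     \<eta>$1 * u$4 + \<eta>$2 * u$1 - \<eta>$3 * u$2,
     - \<eta>$1 * u$3 + \<eta>$2 * u$2 + \<eta>$3 * u$1]"

lemma bounded_bilinear_quat_im: "bounded_bilinear quat_im"
proof -
  have "bilinear quat_im"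
    unfolding bilinear_def
    by (intro conjI allI; rule linearI; simp add: quat_im_def components algebra_simps)
  then show ?thesis
    by (simp only: bilinear_conv_bounded_bilinear)
qed

lemma heisenberg_type_quat_im: "heisenberg_type quat_im lmult"
proof -
  have "lmult \<eta> (lmult \<eta> u) = - ((norm \<eta>)\<^sup>2 *\<^sub>R u)" for \<eta> u
    unfolding power2_norm_eq_inner
    by (simp add: lmult_def components inner_vec_def sum_3 algebra_simps)
  then show ?thesis
    by (intro heisenberg_type.intro heisenberg_type_axioms.intro bounded_bilinear_quat_im)
      (simp_all add: quat_im_def lmult_def components inner_vec_def sum_3 sum_4 algebra_simps)
qed

interpretation quat: heisenberg_type quat_im lmult
  by (rule heisenberg_type_quat_im)

text \<open>
  Left and right multiplications are the two halves of the rotation algebra of \<open>\<real>\<^sup>4\<close>. The imaginary part of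
  \<open>u\<close> times the conjugate of \<open>q\<close> is conjugated by a common left factor of \<open>q\<close> and \<open>u\<close>, which infinitesimally
  is a rotation of the center, and is unchanged by a common right factor of norm one.
\<close>

lemma lmult_derivation: "2 *\<^sub>R cross3 \<alpha> (quat_im q u) = quat_im (lmult \<alpha> q) u + quat_im q (lmult \<alpha> u)"
  by (simp add: quat_im_def lmult_def cross3_def components algebra_simps)

lemma rmult_derivation: "quat_im (rmult \<beta> q) u + quat_im q (rmult \<beta> u) = 0"
  by (simp add: quat_im_def rmult_def components algebra_simps)

lemma linear_lmult_rmult: "linear (\<lambda>q. lmult \<alpha> q + rmult \<beta> q)"
  by (rule linearI) (simp_all add: lmult_def rmult_def components algebra_simps)

lemma inner_lmult_rmult_self: "(lmult \<alpha> q + rmult \<beta> q) \<bullet> q = 0"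
  by (simp add: lmult_def rmult_def components inner_vec_def sum_4 algebra_simps)

text \<open>
  The six entries of a skew matrix below the diagonal pair off into (2,1) and (4,3), (3,1) and (4,2),
  (4,1) and (3,2); left and right multiplications are the matrices whose paired entries agree up to
  one sign pattern or its opposite, so half-sums and half-differences give the two parts.
\<close>

lemma skew_eq_lmult_plus_rmult:
  fixes B :: "real^4 \<Rightarrow> real^4"
  assumes "linear B" "\<And>x. B x \<bullet> x = 0"
  obtains \<alpha> \<beta> where "\<And>q. B q = lmult \<alpha> q + rmult \<beta> q"
proof -
  define b where "b i j = B (axis j 1) $ i" for i j
  have B: "B q $ i = (\<Sum>j\<in>UNIV. q$j * b i j)" for q i
  proof -
    have "B q = B (\<Sum>j\<in>UNIV. q$j *\<^sub>R axis j 1)"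
      by (simp add: basis_expansion flip: scalar_mult_eq_scaleR)
    also have "\<dots> = (\<Sum>j\<in>UNIV. q$j *\<^sub>R B (axis j 1))"
      by (simp add: linear_sum[OF assms(1)] linear_scale[OF assms(1)])
    finally show ?thesis
      by (simp add: b_def)
  qed
  have skew: "b i j = - b j i" for i j
    using skew_adjoint[OF assms, of "axis j 1" "axis i 1"] by (simp add: b_def inner_axis)
  have diag: "b i i = 0" for i
    using skew[of i i] by linarith
  define \<alpha> :: "real^3" where
    "\<alpha> = vector [(b 2 1 + b 4 3) / 2, (b 3 1 - b 4 2) / 2, (b 4 1 + b 3 2) / 2]"
  define \<beta> :: "real^3" where
    "\<beta> = vector [(b 2 1 - b 4 3) / 2, (b 3 1 + b 4 2) / 2, (b 4 1 - b 3 2) / 2]"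
  have "B q = lmult \<alpha> q + rmult \<beta> q" for q
    by (simp add: components B sum_4 lmult_def rmult_def \<alpha>_def \<beta>_def diag
        skew[of 1 2] skew[of 1 3] skew[of 1 4] skew[of 2 3] skew[of 2 4] skew[of 3 4] field_simps)
  then show thesis
    by (rule that)
qed

section \<open>The Killing equation of the metric\<close>

definition contact :: "real \<Rightarrow> real^7 \<Rightarrow> real^7 \<Rightarrow> real^3" where
  "contact l p u = ver u + (l / 2) *\<^sub>R quat_im (hor p) (hor u)"

lemma ebcv_metric_0_eq:
  "ebcv_metric 0 l p u v = hor u \<bullet> hor v + contact l p u \<bullet> contact l p v"
  by (simp add: ebcv_metric_def ebcv_K_def ebcv_r_def ebcv_s_def ebcv_t_def contact_def
      hor_def ver_def quat_im_def components inner_vec_def sum_3 sum_4)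

lemma contact_add: "contact l p (u + v) = contact l p u + contact l p v"
  and contact_diff: "contact l p (u - v) = contact l p u - contact l p v"
  by (simp_all add: contact_def hor_linear_simps quat.add_right quat.diff_right algebra_simps)

lemma contact_has_derivative:
  assumes "(Y has_derivative Y') (at p)"
  shows "((\<lambda>q. contact l q (Y q)) has_derivative
    (\<lambda>v. contact l p (Y' v) + (l / 2) *\<^sub>R quat_im (hor v) (hor (Y p)))) (at p)"
  unfolding contact_def
  by (auto intro!: derivative_eq_intros assms bounded_linear.has_derivative[OF bounded_linear_hor]
      bounded_linear.has_derivative[OF bounded_linear_ver] quat.FDERIV simp: algebra_simps)

text \<open>
  The derivatives of \<open>Y\<close> and \<open>Z\<close> cancel: the Lie derivative of a metric is a tensor.
\<close>

lemma lie_derivative_ebcv_metric_0: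
  assumes X: "(X has_derivative X') (at p)" and Y: "(Y has_derivative Y') (at p)"
    and Z: "(Z has_derivative Z') (at p)"
  shows "lie_derivative_metric X (ebcv_metric 0 l) Y Z p =
    ebcv_metric 0 l p (X' (Y p)) (Z p) + ebcv_metric 0 l p (Y p) (X' (Z p))
    + (l / 2) * (quat_im (hor (X p)) (hor (Y p)) \<bullet> contact l p (Z p)
               + contact l p (Y p) \<bullet> quat_im (hor (X p)) (hor (Z p)))"
proof -
  have "((\<lambda>q. ebcv_metric 0 l q (Y q) (Z q)) has_derivative
    (\<lambda>v. hor (Y p) \<bullet> hor (Z' v) + hor (Y' v) \<bullet> hor (Z p)
      + (contact l p (Y p) \<bullet> (contact l p (Z' v) + (l / 2) *\<^sub>R quat_im (hor v) (hor (Z p)))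
       + (contact l p (Y' v) + (l / 2) *\<^sub>R quat_im (hor v) (hor (Y p))) \<bullet> contact l p (Z p)))) (at p)"
    unfolding ebcv_metric_0_eq
    by (intro has_derivative_add has_derivative_inner contact_has_derivative Y Z
        bounded_linear.has_derivative[OF bounded_linear_hor])
  note g' = frechet_derivative_at[OF this, symmetric]
  have brackets: "lie_bracket X Y p = Y' (X p) - X' (Y p)" "lie_bracket X Z p = Z' (X p) - X' (Z p)"
    unfolding lie_bracket_def
    using frechet_derivative_at[OF X] frechet_derivative_at[OF Y] frechet_derivative_at[OF Z] by metis+
  show ?thesis
    unfolding lie_derivative_metric_def g' brackets
    unfolding ebcv_metric_0_eq contact_diff hor_linear_simps
    by (simp add: inner_add_left inner_add_right inner_diff_left inner_diff_right algebra_simps)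
qed

lemma affine_in_vector_fields:
  fixes L :: "'a::euclidean_space \<Rightarrow> 'a"
  assumes "linear L"
  shows "(\<lambda>p. a + L p) \<in> vector_fields UNIV"
proof -
  have const: "Ck_on k (\<lambda>_. c) UNIV" for k and c :: 'a
    by (cases k) (simp_all add: Ck_on_zero)
  have d: "((\<lambda>p. a + L p) has_derivative L) (at p)" for p
    using assms by (auto intro!: derivative_eq_intros linear_imp_has_derivative)
  have "Ck_on k (\<lambda>p. a + L p) UNIV" for k
  proof (cases k)
    case 0
    then show ?thesis
      by (auto intro!: continuous_at_imp_continuous_on has_derivative_continuous[OF d])
  next
    case (Suc j)
    then show ?thesis
      using d by (auto simp: const differentiable_def frechet_derivative_at[OF d, symmetric])
  qed
  then show ?thesis
    by (simp add: vector_fields_def smooth_on_def)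
qed

text \<open>
  Half the Lie derivative of the metric at \<open>p\<close> on the pair \<open>(u, u)\<close>, where \<open>X'\<close> is the derivative of
  \<open>X\<close> at \<open>p\<close>.
\<close>

definition killing_defect :: "real \<Rightarrow> (real^7 \<Rightarrow> real^7) \<Rightarrow> (real^7 \<Rightarrow> real^7) \<Rightarrow> real^7 \<Rightarrow> real^7 \<Rightarrow> real" where
  "killing_defect l X X' p u = ebcv_metric 0 l p (X' u) u
     + (l / 2) * (quat_im (hor (X p)) (hor u) \<bullet> contact l p u)"

text \<open>
  Constant test fields give one direction; the other one is polarization of the symmetric tensor.
\<close>

lemma killing_fields_iff_defect:
  assumes X: "X \<in> vector_fields UNIV" and X': "\<And>p. (X has_derivative X' p) (at p)"
  shows "X \<in> killing_fields (EBCV 0) (ebcv_metric 0 l) \<longleftrightarrow> (\<forall>p u. killing_defect l X (X' p) p u = 0)"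
proof
  assume K: "X \<in> killing_fields (EBCV 0) (ebcv_metric 0 l)"
  show "\<forall>p u. killing_defect l X (X' p) p u = 0"
  proof (intro allI)
    fix p u :: "real^7"
    have const: "(\<lambda>_. u) \<in> vector_fields UNIV"
      using affine_in_vector_fields[of "\<lambda>_. 0" u] by (simp add: linear_zero)
    have "lie_derivative_metric X (ebcv_metric 0 l) (\<lambda>_. u) (\<lambda>_. u) p = 0"
      using K const by (simp add: killing_fields_def EBCV_0)
    then show "killing_defect l X (X' p) p u = 0"
      using lie_derivative_ebcv_metric_0[OF X'[of p] has_derivative_const[of u] has_derivative_const[of u], of l]
        ebcv_metric_sym[of 0 l p u "X' p u"]
      by (simp add: killing_defect_def inner_commute)
  qed
next
  assume K: "\<forall>p u. killing_defect l X (X' p) p u = 0"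
  have "lie_derivative_metric X (ebcv_metric 0 l) Y Z p = 0"
    if Y: "Y \<in> vector_fields UNIV" and Z: "Z \<in> vector_fields UNIV" for Y Z p
  proof -
    obtain Y' Z' where YZ': "(Y has_derivative Y') (at p)" "(Z has_derivative Z') (at p)"
      using vector_fields_differentiable[OF Y, of p] vector_fields_differentiable[OF Z, of p]
      by (auto simp: differentiable_def)
    have "killing_defect l X (X' p) p (Y p + Z p) - killing_defect l X (X' p) p (Y p)
        - killing_defect l X (X' p) p (Z p) = lie_derivative_metric X (ebcv_metric 0 l) Y Z p"
      unfolding lie_derivative_ebcv_metric_0[OF X' YZ'] killing_defect_def ebcv_metric_0_eq
        linear_add[OF has_derivative_linear[OF X']] contact_add hor_linear_simps quat.add_right
      by (simp add: inner_add_left inner_add_right inner_commute algebra_simps)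
    then show ?thesis
      using K by simp
  qed
  then show "X \<in> killing_fields (EBCV 0) (ebcv_metric 0 l)"
    using X by (simp add: killing_fields_def EBCV_0)
qed

section \<open>The space of Killing fields\<close>

text \<open>
  The parameters are a horizontal and a central translation, and a left and a right rotation of the
  horizontal space. The left one is accompanied by the rotation of the center that makes the pair a
  derivation.
\<close>

definition affine_field :: "real \<Rightarrow> (real^4) \<times> (real^3) \<times> (real^3) \<times> (real^3) \<Rightarrow> real^7 \<Rightarrow> real^7" where
  "affine_field l = (\<lambda>(v, z, \<alpha>, \<beta>) p.
     join (v + (lmult \<alpha> (hor p) + rmult \<beta> (hor p)))
       (z + 2 *\<^sub>R cross3 \<alpha> (ver p) + (l / 2) *\<^sub>R quat_im (hor p) v))"

lemma affine_field_killing: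
  "affine_field l x \<in> killing_fields (EBCV 0) (ebcv_metric 0 l)"
proof (cases x)
  case (fields v z \<alpha> \<beta>)
  define B where "B q = lmult \<alpha> q + rmult \<beta> q" for q
  define L where "L p = join (B (hor p)) (2 *\<^sub>R cross3 \<alpha> (ver p) + (l / 2) *\<^sub>R quat_im (hor p) v)" for p
  have BL: "linear B"
    unfolding B_def by (rule linear_lmult_rmult)
  have eq: "affine_field l x = (\<lambda>p. join v z + L p)"
    by (simp add: fun_eq_iff affine_field_def fields L_def B_def join_add[symmetric] add.assoc)
  have linL: "linear L"
    by (rule linearI)
      (simp_all add: L_def hor_linear_simps linear_add[OF BL] linear_scale[OF BL] quat.add_left
        quat.scaleR_left cross_add_right cross_mult_right join_add[symmetric] join_scaleR[symmetric]
        algebra_simps)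
  have deriv: "(affine_field l x has_derivative L) (at p)" for p
    unfolding eq using linL by (auto intro!: derivative_eq_intros linear_imp_has_derivative)
  have derivation: "quat_im (B q) u + quat_im q (B u) = 2 *\<^sub>R cross3 \<alpha> (quat_im q u)" for q u
    using rmult_derivation[of \<beta> q u]
    by (simp add: B_def quat.add_left quat.add_right lmult_derivation algebra_simps)
  have "killing_defect l (affine_field l x) L p u = 0" for p u
  proof -
    have "contact l p (L u) + (l / 2) *\<^sub>R quat_im (hor (affine_field l x p)) (hor u)
        = 2 *\<^sub>R cross3 \<alpha> (ver u) + (l / 2) *\<^sub>R (quat_im (B (hor p)) (hor u) + quat_im (hor p) (B (hor u)))"
      using quat.om_skew[of v "hor u"]
      by (simp add: eq contact_def L_def hor_linear_simps quat.add_left algebra_simps)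
    also have "\<dots> = 2 *\<^sub>R cross3 \<alpha> (contact l p u)"
      by (simp add: derivation contact_def cross_add_right cross_mult_right scaleR_add_right)
    finally have "(contact l p (L u) + (l / 2) *\<^sub>R quat_im (hor (affine_field l x p)) (hor u)) \<bullet> contact l p u = 0"
      by (simp add: dot_cross_self)
    moreover have "hor (L u) \<bullet> hor u = 0"
      by (simp add: L_def B_def inner_lmult_rmult_self)
    ultimately show ?thesis
      by (simp add: killing_defect_def ebcv_metric_0_eq inner_add_left)
  qed
  then show ?thesis
    using killing_fields_iff_defect[OF _ deriv] affine_in_vector_fields[OF linL] by (simp add: eq)
qed

text \<open>
  The components of a Killing field in the coframe satisfy the hypotheses of the classification. The skew
  map \<open>B\<close> found there is a left plus a right multiplication, and it determines \<open>H\<close> because every central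
  vector is a bracket.
\<close>

lemma killing_is_affine_field:
  assumes l: "l \<noteq> 0" and K: "X \<in> killing_fields (EBCV 0) (ebcv_metric 0 l)"
  shows "X \<in> range (affine_field l)"
proof -
  have X: "X \<in> vector_fields UNIV"
    using K by (simp add: killing_fields_def EBCV_0)
  define X' where "X' p = frechet_derivative X (at p)" for p
  have X': "(X has_derivative X' p) (at p)" for p
    using vector_fields_differentiable[OF X, of p] by (simp add: X'_def frechet_derivative_works)
  have defect: "killing_defect l X (X' p) p u = 0" for p u
    using killing_fields_iff_defect[OF X X'] K by blast
  define f where "f x = hor (X (join (fst x) (snd x)))" for x
  define h where "h x = contact l (join (fst x) (snd x)) (X (join (fst x) (snd x)))" for x
  define D where "D x d = X' (join (fst x) (snd x)) (join (fst d) (snd d))" for x d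
  have D: "((\<lambda>x. X (join (fst x) (snd x))) has_derivative D x) (at x)" for x
    unfolding D_def
    by (rule has_derivative_compose[OF bounded_linear_imp_has_derivative[OF bounded_linear_join] X'])
  define h' where "h' x d = contact l (join (fst x) (snd x)) (D x d) + (l / 2) *\<^sub>R quat_im (fst d) (f x)" for x d
  interpret heisenberg_killing quat_im lmult l f "\<lambda>x d. hor (D x d)" h h'
  proof
    show "l \<noteq> 0" by (rule l)
    show "2 \<le> DIM(real^3)" by simp
    show "(f has_derivative (\<lambda>d. hor (D p d))) (at p)" for p
      unfolding f_def by (rule bounded_linear.has_derivative[OF bounded_linear_hor D])
    show "(h has_derivative h' x) (at x)" for x
      using has_derivative_compose[OF bounded_linear_imp_has_derivative[OF bounded_linear_join]
          contact_has_derivative[OF X', of l], of x UNIV]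
      by (simp add: h_def[abs_def] h'_def[abs_def] D_def f_def)
    show "u \<bullet> hor (D (q, c) (u, \<eta> - (l / 2) *\<^sub>R quat_im q u))
        + \<eta> \<bullet> h' (q, c) (u, \<eta> - (l / 2) *\<^sub>R quat_im q u) = l * (\<eta> \<bullet> quat_im u (f (q, c)))" for u q c \<eta>
    proof -
      have "contact l (join q c) (join u (\<eta> - (l / 2) *\<^sub>R quat_im q u)) = \<eta>"
        by (simp add: contact_def)
      then show ?thesis
        using defect[of "join q c" "join u (\<eta> - (l / 2) *\<^sub>R quat_im q u)"] quat.om_skew[of "f (q, c)" u]
        by (simp add: killing_defect_def ebcv_metric_0_eq h'_def D_def f_def inner_add_right inner_commute
            algebra_simps)
    qed
  qed
  obtain B H v z where B: "linear B" "\<And>x. B x \<bullet> x = 0"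
    and "linear H" "\<And>x. H x \<bullet> x = 0"
    and derivation: "\<And>q u. H (quat_im q u) = quat_im (B q) u + quat_im q (B u)"
    and f: "\<And>q c. f (q, c) = v + B q"
    and h: "\<And>q c. h (q, c) - (l / 2) *\<^sub>R quat_im q (f (q, c)) = z + H c + (l / 2) *\<^sub>R quat_im q v"
    by (fact killing_classification)
  obtain \<alpha> \<beta> where \<alpha>\<beta>: "\<And>q. B q = lmult \<alpha> q + rmult \<beta> q"
    using skew_eq_lmult_plus_rmult[OF B] by blast
  have H: "H c = 2 *\<^sub>R cross3 \<alpha> c" for c
  proof -
    \<comment> \<open>\<open>e\<close> is the quaternion 1, so its bracket with \<open>u\<close> is the imaginary part of \<open>u\<close>.\<close>
    define e u :: "real^4" where "e = vector [1, 0, 0, 0]" and "u = vector [0, c$1, c$2, c$3]"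
    have c: "c = quat_im e u"
      by (simp add: e_def u_def quat_im_def components)
    show ?thesis
      unfolding c derivation \<alpha>\<beta>
      using rmult_derivation[of \<beta> e u]
      by (simp add: quat.add_left quat.add_right lmult_derivation algebra_simps)
  qed
  have "X = affine_field l (v, z, \<alpha>, \<beta>)"
  proof
    fix p
    have "hor (X p) = v + (lmult \<alpha> (hor p) + rmult \<beta> (hor p))"
      using f[of "hor p" "ver p"] by (simp add: f_def \<alpha>\<beta>)
    moreover have "ver (X p) = z + 2 *\<^sub>R cross3 \<alpha> (ver p) + (l / 2) *\<^sub>R quat_im (hor p) v"
      using h[of "hor p" "ver p"] by (simp add: h_def f_def contact_def H)
    ultimately have "join (hor (X p)) (ver (X p)) = affine_field l (v, z, \<alpha>, \<beta>) p"
      by (simp only: affine_field_def case_prod_conv)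
    then show "X p = affine_field l (v, z, \<alpha>, \<beta>) p"
      by simp
  qed
  then show ?thesis
    by blast
qed

lemma linear_affine_field: "Vector_Spaces.linear scaleR scale_field (affine_field l)"
  by unfold_locales
    (auto simp: affine_field_def fun_eq_iff join_add[symmetric] join_scaleR[symmetric] lmult_def
      rmult_def quat.add_right quat.scaleR_right cross_add_left cross_mult_left join_def components
      algebra_simps)

lemma inj_affine_field: "inj (affine_field l)"
proof (rule injI)
  fix x y
  assume "affine_field l x = affine_field l y"
  moreover obtain v z \<alpha> \<beta> where x: "x = (v, z, \<alpha>, \<beta>)" by (cases x)
  moreover obtain v' z' \<alpha>' \<beta>' where y: "y = (v', z', \<alpha>', \<beta>')" by (cases y)
  ultimately have eq: "affine_field l (v, z, \<alpha>, \<beta>) p = affine_field l (v', z', \<alpha>', \<beta>') p" for p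
    by simp
  have *: "v + (lmult \<alpha> q + rmult \<beta> q) = v' + (lmult \<alpha>' q + rmult \<beta>' q)"
    "z + 2 *\<^sub>R cross3 \<alpha> c + (l / 2) *\<^sub>R quat_im q v = z' + 2 *\<^sub>R cross3 \<alpha>' c + (l / 2) *\<^sub>R quat_im q v'" for q c
    using arg_cong[OF eq[of "join q c"], of hor] arg_cong[OF eq[of "join q c"], of ver]
    by (simp_all add: affine_field_def)
  have v: "v = v'"
    using *(1)[of 0] by (simp add: lmult_def rmult_def components)
  have z: "z = z'"
    using *(2)[where q = 0 and c = 0] by (simp add: quat.zero_left)
  have \<alpha>: "\<alpha> = \<alpha>'"
    using *(2)[where q = 0 and c = "vector [1, 0, 0]"] *(2)[where q = 0 and c = "vector [0, 1, 0]"]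
    by (simp add: z quat.zero_left cross3_def components)
  have \<beta>: "\<beta> = \<beta>'"
    using *(1)[of "vector [1, 0, 0, 0]"] by (simp add: v \<alpha> lmult_def rmult_def components)
  show "x = y"
    by (simp add: x y v z \<alpha> \<beta>)
qed

theorem proposition9:
  fixes l :: real
  assumes "l \<noteq> 0"
  shows "field_space.dim (killing_fields (EBCV 0) (ebcv_metric 0 l)) = 13"
proof -
  let ?P = "UNIV :: ((real^4) \<times> (real^3) \<times> (real^3) \<times> (real^3)) set"
  have "killing_fields (EBCV 0) (ebcv_metric 0 l) = affine_field l ` ?P"
    using killing_is_affine_field[OF assms] affine_field_killing by blast
  moreover interpret finite_dimensional_vector_space_pair_1 scaleR Basis
    "scale_field :: real \<Rightarrow> (real^7 \<Rightarrow> real^7) \<Rightarrow> real^7 \<Rightarrow> real^7" by unfold_locales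
  have "field_space.dim (affine_field l ` ?P) = dim ?P"
    using dim_image_eq[OF linear_affine_field] inj_affine_field by (simp add: inj_on_subset)
  ultimately show ?thesis
    by simp
qed

end
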